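(* Let $X$ and $Y$ be real Banach spaces, let $x_0^*\in S_{X^*}$ and $y_0^*\in S_{Y^*}$. Suppose that the rank one operator $x_0^*\otimes y_0^*\in S_{\mathcal{L}(X,Y^* )}$ is a weak$^*$-strongly extreme point of $B_{\mathcal{L}(X,Y^* )}$. Then $x_0^*$ is a weak$^*$-strongly extreme point of $B_{X^*}$ and $y_0^*$ is a weak$^*$-strongly extreme point of $B_{Y^*}$.
   Context: $B_Z$ and $S_Z$ denote the closed unit ball and unit sphere of a Banach space $Z$. A weak$^*$-slice of $B_{Z^*}$ is a set $\{z^*\in B_{Z^*}: z^*(z)>\sup_{w^*\in B_{Z^*}}w^*(z)-\alpha\}$ with $z\in Z$ and $\alpha>0$. A point $z_0^*\in S_{Z^*}$ is a weak$^*$-strongly extreme point of $B_{Z^*}$ if the family of weak$^*$-slices of $B_{Z^*}$ containing $z_0^*$ forms a local base at $z_0^*$ for the (relative) weak topology on $B_{Z^*}$, the weak topology of $Z^*$ being the one induced by $Z^{**}$. $\mathcal{L}(X,Y^* )$ is the space of bounded linear operators from $X$ to $Y^*$ with the operator norm; it is identified isometrically with the dual of the projective tensor product $X\hat{\otimes}_\pi Y$ via $T(x\otimes y)=(Tx)(y)$, and its weak$^*$-topology (and weak$^*$-slices) are always those coming from this predual. $x_0^*\otimes y_0^*$ is the operator $x\mapsto x_0^*(x)\,y_0^*$. *)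

theory Defs
  imports "HOL-Analysis.Analysis"
begin

section \<open>The algebraic tensor product\<close>

text \<open>
  The tensor \<open>x \<otimes> y\<close> is the evaluation at \<open>(x, y)\<close> on the space of all (not necessarily
  bounded) bilinear forms, and the algebraic tensor product is the space of all finite sums of
  such evaluations.  Functionals are set to \<open>0\<close> outside the bilinear forms, so that equality
  of tensors is equality on bilinear forms.
\<close>

typedef (overloaded) ('a::real_normed_vector, 'b::real_normed_vector) tensor =
  "{u :: ('a \<Rightarrow> 'b \<Rightarrow> real) \<Rightarrow> real.
     \<exists>l. u = (\<lambda>A. if bilinear A then (\<Sum>(x, y)\<leftarrow>l. A x y) else 0)}"
  morphisms tensor_apply Abs_tensor
  by blast

setup_lifting type_definition_tensor

lift_definition elem_tensor ::
    "'a::real_normed_vector \<Rightarrow> 'b::real_normed_vector \<Rightarrow> ('a, 'b) tensor"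
  is "\<lambda>x y A. if bilinear A then A x y else 0"
  subgoal for x y by (rule exI[of _ "[(x, y)]"]) auto
  done

lemma bilinear_sum_list_scaleR:
  "bilinear A \<Longrightarrow>
    (\<Sum>(x, y)\<leftarrow>map (\<lambda>(x, y). (c *\<^sub>R x, y)) l. A x y) = c * (\<Sum>(x, y)\<leftarrow>l. A x y)"
  for A :: "'a::real_normed_vector \<Rightarrow> 'b::real_normed_vector \<Rightarrow> real"
  by (induction l) (auto simp: bilinear_lmul distrib_left)

instantiation tensor :: (real_normed_vector, real_normed_vector) real_vector
begin

lift_definition zero_tensor :: "('a, 'b) tensor" is "\<lambda>_. 0"
  by (rule exI[of _ "[]"]) auto

lift_definition plus_tensor :: "('a, 'b) tensor \<Rightarrow> ('a, 'b) tensor \<Rightarrow> ('a, 'b) tensor"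
  is "\<lambda>u v A. u A + v A"
  apply clarify
  subgoal for _ _ l k by (rule exI[of _ "l @ k"]) auto
  done

lift_definition scaleR_tensor :: "real \<Rightarrow> ('a, 'b) tensor \<Rightarrow> ('a, 'b) tensor"
  is "\<lambda>c u A. c * u A"
  apply clarify
  subgoal for c _ l
    apply (rule exI[of _ "map (\<lambda>(x, y). (c *\<^sub>R x, y)) l"])
    by (rule ext) (simp add: bilinear_sum_list_scaleR del: map_map)
  done

definition uminus_tensor :: "('a, 'b) tensor \<Rightarrow> ('a, 'b) tensor"
  where "uminus_tensor u = (- 1) *\<^sub>R u"

definition minus_tensor :: "('a, 'b) tensor \<Rightarrow> ('a, 'b) tensor \<Rightarrow> ('a, 'b) tensor"
  where "minus_tensor u v = u + - v"

instance
  by standard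
    (unfold minus_tensor_def uminus_tensor_def,
      (transfer, auto simp: algebra_simps)+)

end

lemma tensor_apply_sum_list:
  "tensor_apply (\<Sum>(x, y)\<leftarrow>l. elem_tensor x y) A =
    (if bilinear A then (\<Sum>(x, y)\<leftarrow>l. A x y) else 0)"
  by (induction l) (auto simp: zero_tensor.rep_eq plus_tensor.rep_eq elem_tensor.rep_eq)

lemma tensor_cases:
  obtains l where "u = (\<Sum>(x, y)\<leftarrow>l. elem_tensor x y)"
proof -
  obtain l where "tensor_apply u = (\<lambda>A. if bilinear A then (\<Sum>(x, y)\<leftarrow>l. A x y) else 0)"
    using tensor_apply[of u] by auto
  then have "u = (\<Sum>(x, y)\<leftarrow>l. elem_tensor x y)"
    by (intro tensor_apply_inject[THEN iffD1] ext) (simp add: tensor_apply_sum_list)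
  then show ?thesis by (rule that)
qed

lemma elem_tensor_add_left: "elem_tensor (x + x') y = elem_tensor x y + elem_tensor x' y"
  by transfer (auto simp: bilinear_ladd)

lemma elem_tensor_add_right: "elem_tensor x (y + y') = elem_tensor x y + elem_tensor x y'"
  by transfer (auto simp: bilinear_radd)

lemma elem_tensor_scaleR_left: "elem_tensor (c *\<^sub>R x) y = c *\<^sub>R elem_tensor x y"
  by transfer (auto simp: bilinear_lmul)

lemma elem_tensor_scaleR_right: "elem_tensor x (c *\<^sub>R y) = c *\<^sub>R elem_tensor x y"
  by transfer (auto simp: bilinear_rmul)

lifting_forget tensor.lifting


section \<open>The projective norm\<close>

definition proj_norm ::
    "('a::real_normed_vector, 'b::real_normed_vector) tensor \<Rightarrow> real"
  where "proj_norm u =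
    Inf {(\<Sum>(x, y)\<leftarrow>l. norm x * norm y) | l. u = (\<Sum>(x, y)\<leftarrow>l. elem_tensor x y)}"

lemma sum_list_norm_nonneg: "0 \<le> (\<Sum>(x, y)\<leftarrow>l. norm x * norm y)"
  by (rule sum_list_nonneg) auto

lemma proj_norm_le:
  "proj_norm (\<Sum>(x, y)\<leftarrow>l. elem_tensor x y) \<le> (\<Sum>(x, y)\<leftarrow>l. norm x * norm y)"
  unfolding proj_norm_def
  by (rule cInf_lower) (auto intro!: bdd_belowI[of _ 0] sum_list_norm_nonneg)

lemma proj_norm_less:
  assumes "proj_norm u < c"
  obtains l where "u = (\<Sum>(x, y)\<leftarrow>l. elem_tensor x y)"
    "(\<Sum>(x, y)\<leftarrow>l. norm x * norm y) < c"
proof -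
  obtain k where "u = (\<Sum>(x, y)\<leftarrow>k. elem_tensor x y)" by (rule tensor_cases)
  then show ?thesis
    using cInf_lessD[OF _ assms[unfolded proj_norm_def]] that by blast
qed

lemma proj_norm_greatest:
  assumes "\<And>l. u = (\<Sum>(x, y)\<leftarrow>l. elem_tensor x y) \<Longrightarrow> c \<le> (\<Sum>(x, y)\<leftarrow>l. norm x * norm y)"
  shows "c \<le> proj_norm u"
  by (rule ccontr) (metis assms not_le proj_norm_less)

lemma proj_norm_nonneg [simp]: "0 \<le> proj_norm u"
  by (rule proj_norm_greatest) (rule sum_list_norm_nonneg)

lemma proj_norm_zero [simp]: "proj_norm (0 :: ('a::real_normed_vector, 'b::real_normed_vector) tensor) = 0"
  using proj_norm_le[of "[] :: ('a \<times> 'b) list"] by (simp add: order_antisym)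

lemma proj_norm_triangle: "proj_norm (u + v) \<le> proj_norm u + proj_norm v"
proof (rule field_le_epsilon)
  fix e :: real assume "0 < e"
  obtain l where l: "u = (\<Sum>(x, y)\<leftarrow>l. elem_tensor x y)"
      "(\<Sum>(x, y)\<leftarrow>l. norm x * norm y) < proj_norm u + e / 2"
    using \<open>0 < e\<close> by (rule_tac proj_norm_less[of u "proj_norm u + e / 2"]) auto
  obtain k where k: "v = (\<Sum>(x, y)\<leftarrow>k. elem_tensor x y)"
      "(\<Sum>(x, y)\<leftarrow>k. norm x * norm y) < proj_norm v + e / 2"
    using \<open>0 < e\<close> by (rule_tac proj_norm_less[of v "proj_norm v + e / 2"]) auto
  show "proj_norm (u + v) \<le> proj_norm u + proj_norm v + e"
    using proj_norm_le[of "l @ k"] l k by simp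
qed

lemma proj_norm_scaleR_le: "proj_norm (c *\<^sub>R u) \<le> \<bar>c\<bar> * proj_norm u"
proof (cases "c = 0")
  case False
  have "proj_norm (c *\<^sub>R u) / \<bar>c\<bar> \<le> proj_norm u"
  proof (rule proj_norm_greatest)
    fix l assume u: "u = (\<Sum>(x, y)\<leftarrow>l. elem_tensor x y)"
    let ?l = "map (\<lambda>(x, y). (c *\<^sub>R x, y)) l"
    have "c *\<^sub>R u = (\<Sum>(x, y)\<leftarrow>?l. elem_tensor x y)"
      unfolding u by (induction l) (auto simp: scaleR_add_right elem_tensor_scaleR_left)
    moreover have "(\<Sum>(x, y)\<leftarrow>?l. norm x * norm y) = \<bar>c\<bar> * (\<Sum>(x, y)\<leftarrow>l. norm x * norm y)"
      by (induction l) (auto simp: distrib_left)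
    ultimately have "proj_norm (c *\<^sub>R u) \<le> \<bar>c\<bar> * (\<Sum>(x, y)\<leftarrow>l. norm x * norm y)"
      using proj_norm_le[of ?l] by simp
    then show "proj_norm (c *\<^sub>R u) / \<bar>c\<bar> \<le> (\<Sum>(x, y)\<leftarrow>l. norm x * norm y)"
      using False by (simp add: divide_simps mult.commute)
  qed
  then show ?thesis using False by (simp add: divide_simps mult.commute)
qed simp

lemma proj_norm_scaleR: "proj_norm (c *\<^sub>R u) = \<bar>c\<bar> * proj_norm u"
proof (cases "c = 0")
  case False
  have "proj_norm (inverse c *\<^sub>R c *\<^sub>R u) \<le> \<bar>inverse c\<bar> * proj_norm (c *\<^sub>R u)"
    by (rule proj_norm_scaleR_le)
  then have "\<bar>c\<bar> * proj_norm u \<le> proj_norm (c *\<^sub>R u)"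
    using False by (simp add: field_simps)
  then show ?thesis by (intro antisym proj_norm_scaleR_le)
qed simp

lemma proj_norm_minus: "proj_norm (- u) = proj_norm u"
  using proj_norm_scaleR[of "-1" u] by simp

lemma proj_norm_minus_commute: "proj_norm (u - v) = proj_norm (v - u)"
  using proj_norm_minus[of "u - v"] by simp

lemma proj_norm_triangle_diff: "\<bar>proj_norm u - proj_norm v\<bar> \<le> proj_norm (u - v)"
  using proj_norm_triangle[of "u - v" v] proj_norm_triangle[of "v - u" u]
    proj_norm_minus_commute[of u v] by simp


section \<open>The projective tensor product as a completion\<close>

text \<open>The completion consists of the \<open>proj_norm\<close>-Cauchy sequences of tensors modulo null sequences,
  normed by \<open>lim\<^sub>n proj_norm (s n)\<close>.\<close>

definition proj_Cauchy ::
    "(nat \<Rightarrow> ('a::real_normed_vector, 'b::real_normed_vector) tensor) \<Rightarrow> bool"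
  where "proj_Cauchy s \<longleftrightarrow> (\<forall>e>0. \<exists>N. \<forall>m\<ge>N. \<forall>n\<ge>N. proj_norm (s m - s n) < e)"

definition proj_rel ::
    "(nat \<Rightarrow> ('a::real_normed_vector, 'b::real_normed_vector) tensor) \<Rightarrow>
      (nat \<Rightarrow> ('a, 'b) tensor) \<Rightarrow> bool"
  where "proj_rel s t \<longleftrightarrow>
    proj_Cauchy s \<and> proj_Cauchy t \<and> (\<lambda>n. proj_norm (s n - t n)) \<longlonglongrightarrow> 0"

lemma proj_Cauchy_const [simp]: "proj_Cauchy (\<lambda>_. u)"
  by (simp add: proj_Cauchy_def)

lemma proj_norm_tendsto_0_bound:
  assumes "\<And>n. proj_norm (s n) \<le> f n" "f \<longlonglongrightarrow> 0"
  shows "(\<lambda>n. proj_norm (s n)) \<longlonglongrightarrow> 0"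
  by (rule tendsto_sandwich[OF _ _ tendsto_const assms(2)]) (use assms(1) in auto)

lemma proj_rel_refl: "proj_Cauchy s \<Longrightarrow> proj_rel s s"
  by (simp add: proj_rel_def)

lemma proj_rel_sym: "proj_rel s t \<Longrightarrow> proj_rel t s"
  by (simp add: proj_rel_def proj_norm_minus_commute)

lemma proj_rel_trans:
  assumes "proj_rel s t" "proj_rel t r" shows "proj_rel s r"
proof -
  have "(\<lambda>n. proj_norm (s n - r n)) \<longlonglongrightarrow> 0"
  proof (rule proj_norm_tendsto_0_bound)
    show "proj_norm (s n - r n) \<le> proj_norm (s n - t n) + proj_norm (t n - r n)" for n
      using proj_norm_triangle[of "s n - t n" "t n - r n"] by simp
    show "(\<lambda>n. proj_norm (s n - t n) + proj_norm (t n - r n)) \<longlonglongrightarrow> 0"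
      using assms by (intro tendsto_eq_intros) (auto simp: proj_rel_def)
  qed
  then show ?thesis using assms by (simp add: proj_rel_def)
qed

quotient_type (overloaded) ('a, 'b) ptensor =
  "nat \<Rightarrow> ('a::real_normed_vector, 'b::real_normed_vector) tensor" / partial: proj_rel
  morphisms rep_ptensor abs_ptensor
proof (rule part_equivpI)
  show "\<exists>s :: nat \<Rightarrow> ('a, 'b) tensor. proj_rel s s"
    by (rule exI[of _ "\<lambda>_. 0"]) (simp add: proj_rel_refl)
  show "symp (proj_rel :: (nat \<Rightarrow> ('a, 'b) tensor) \<Rightarrow> _)"
    by (auto intro!: sympI proj_rel_sym)
  show "transp (proj_rel :: (nat \<Rightarrow> ('a, 'b) tensor) \<Rightarrow> _)"
    by (auto intro!: transpI elim: proj_rel_trans)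
qed

lemma proj_Cauchy_add:
  assumes "proj_Cauchy s" "proj_Cauchy t"
  shows "proj_Cauchy (\<lambda>n. s n + t n)"
  unfolding proj_Cauchy_def
proof (intro allI impI)
  fix e :: real assume "0 < e"
  then obtain M N where
    "\<And>m n. m \<ge> M \<Longrightarrow> n \<ge> M \<Longrightarrow> proj_norm (s m - s n) < e / 2"
    "\<And>m n. m \<ge> N \<Longrightarrow> n \<ge> N \<Longrightarrow> proj_norm (t m - t n) < e / 2"
    using assms unfolding proj_Cauchy_def by (meson half_gt_zero)
  moreover have "proj_norm ((s m + t m) - (s n + t n)) \<le>
      proj_norm (s m - s n) + proj_norm (t m - t n)" for m n
    using proj_norm_triangle[of "s m - s n" "t m - t n"] by (simp add: algebra_simps)
  ultimately show "\<exists>N. \<forall>m\<ge>N. \<forall>n\<ge>N. proj_norm ((s m + t m) - (s n + t n)) < e"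
    by (intro exI[of _ "max M N"]) (smt (verit) field_sum_of_halves max.bounded_iff)
qed

lemma proj_Cauchy_scaleR:
  assumes "proj_Cauchy s"
  shows "proj_Cauchy (\<lambda>n. c *\<^sub>R s n)"
  unfolding proj_Cauchy_def
proof (intro allI impI)
  fix e :: real assume "0 < e"
  then have "0 < e / (\<bar>c\<bar> + 1)" by simp
  then obtain N where N:
    "\<And>m n. m \<ge> N \<Longrightarrow> n \<ge> N \<Longrightarrow> proj_norm (s m - s n) < e / (\<bar>c\<bar> + 1)"
    using assms unfolding proj_Cauchy_def by meson
  have "proj_norm (c *\<^sub>R s m - c *\<^sub>R s n) < e" if "m \<ge> N" "n \<ge> N" for m n
  proof -
    have "proj_norm (c *\<^sub>R s m - c *\<^sub>R s n) = \<bar>c\<bar> * proj_norm (s m - s n)"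
      by (metis proj_norm_scaleR scaleR_right_diff_distrib)
    also have "\<dots> \<le> (\<bar>c\<bar> + 1) * proj_norm (s m - s n)"
      by (intro mult_right_mono) auto
    also have "\<dots> < e" using N[OF that] by (simp add: field_simps)
    finally show ?thesis .
  qed
  then show "\<exists>N. \<forall>m\<ge>N. \<forall>n\<ge>N. proj_norm (c *\<^sub>R s m - c *\<^sub>R s n) < e" by blast
qed

lemma proj_rel_add:
  assumes "proj_rel s s'" "proj_rel t t'"
  shows "proj_rel (\<lambda>n. s n + t n) (\<lambda>n. s' n + t' n)"
proof -
  have "(\<lambda>n. proj_norm ((s n + t n) - (s' n + t' n))) \<longlonglongrightarrow> 0"
  proof (rule proj_norm_tendsto_0_bound)
    show "proj_norm ((s n + t n) - (s' n + t' n)) \<le>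
        proj_norm (s n - s' n) + proj_norm (t n - t' n)" for n
      using proj_norm_triangle[of "s n - s' n" "t n - t' n"] by (simp add: algebra_simps)
    show "(\<lambda>n. proj_norm (s n - s' n) + proj_norm (t n - t' n)) \<longlonglongrightarrow> 0"
      using assms by (intro tendsto_eq_intros) (auto simp: proj_rel_def)
  qed
  then show ?thesis using assms by (simp add: proj_rel_def proj_Cauchy_add)
qed

lemma proj_rel_scaleR:
  assumes "proj_rel s t"
  shows "proj_rel (\<lambda>n. c *\<^sub>R s n) (\<lambda>n. c *\<^sub>R t n)"
proof -
  have "proj_norm (c *\<^sub>R s n - c *\<^sub>R t n) = \<bar>c\<bar> * proj_norm (s n - t n)" for n
    by (metis proj_norm_scaleR scaleR_right_diff_distrib)
  then have "(\<lambda>n. proj_norm (c *\<^sub>R s n - c *\<^sub>R t n)) \<longlonglongrightarrow> 0"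
    using assms by (auto simp: proj_rel_def intro!: tendsto_eq_intros)
  then show ?thesis using assms by (simp add: proj_rel_def proj_Cauchy_scaleR)
qed

lemma proj_norm_convergent:
  assumes "proj_Cauchy s"
  shows "convergent (\<lambda>n. proj_norm (s n))"
  unfolding Cauchy_convergent_iff[symmetric]
proof (rule metric_CauchyI)
  fix e :: real assume "0 < e"
  then show "\<exists>M. \<forall>m\<ge>M. \<forall>n\<ge>M. dist (proj_norm (s m)) (proj_norm (s n)) < e"
    using assms proj_norm_triangle_diff unfolding proj_Cauchy_def dist_real_def
    by (meson le_less_trans)
qed

lemma proj_rel_norm:
  assumes "proj_rel s t"
  shows "lim (\<lambda>n. proj_norm (s n)) = lim (\<lambda>n. proj_norm (t n))"
proof (rule limI)
  have t: "(\<lambda>n. proj_norm (t n)) \<longlonglongrightarrow> lim (\<lambda>n. proj_norm (t n))"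
    using assms proj_norm_convergent convergent_LIMSEQ_iff unfolding proj_rel_def by blast
  have "(\<lambda>n. proj_norm (s n) - proj_norm (t n)) \<longlonglongrightarrow> 0"
    by (rule Lim_null_comparison[of _ "\<lambda>n. proj_norm (s n - t n)"])
      (use assms in \<open>simp_all add: proj_rel_def proj_norm_triangle_diff\<close>)
  from tendsto_add[OF this t]
  show "(\<lambda>n. proj_norm (s n)) \<longlonglongrightarrow> lim (\<lambda>n. proj_norm (t n))" by simp
qed

instantiation ptensor :: (real_normed_vector, real_normed_vector) real_normed_vector
begin

lift_definition zero_ptensor :: "('a, 'b) ptensor" is "\<lambda>_. 0"
  by (simp add: proj_rel_refl)

lift_definition plus_ptensor :: "('a, 'b) ptensor \<Rightarrow> ('a, 'b) ptensor \<Rightarrow> ('a, 'b) ptensor"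
  is "\<lambda>s t n. s n + t n"
  by (rule proj_rel_add)

lift_definition scaleR_ptensor :: "real \<Rightarrow> ('a, 'b) ptensor \<Rightarrow> ('a, 'b) ptensor"
  is "\<lambda>c s n. c *\<^sub>R s n"
  by (rule proj_rel_scaleR)

lift_definition norm_ptensor :: "('a, 'b) ptensor \<Rightarrow> real"
  is "\<lambda>s. lim (\<lambda>n. proj_norm (s n))"
  by (rule proj_rel_norm)

definition uminus_ptensor :: "('a, 'b) ptensor \<Rightarrow> ('a, 'b) ptensor"
  where "uminus_ptensor u = (- 1) *\<^sub>R u"

definition minus_ptensor :: "('a, 'b) ptensor \<Rightarrow> ('a, 'b) ptensor \<Rightarrow> ('a, 'b) ptensor"
  where "minus_ptensor u v = u + - v"

definition sgn_ptensor :: "('a, 'b) ptensor \<Rightarrow> ('a, 'b) ptensor"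
  where "sgn_ptensor u = inverse (norm u) *\<^sub>R u"

definition dist_ptensor :: "('a, 'b) ptensor \<Rightarrow> ('a, 'b) ptensor \<Rightarrow> real"
  where "dist_ptensor u v = norm (u - v)"

definition uniformity_ptensor :: "(('a, 'b) ptensor \<times> ('a, 'b) ptensor) filter"
  where "uniformity_ptensor = (INF e\<in>{0<..}. principal {(x, y). dist x y < e})"

definition open_ptensor :: "('a, 'b) ptensor set \<Rightarrow> bool"
  where "open_ptensor U = (\<forall>x\<in>U. \<forall>\<^sub>F (x', y) in uniformity. x' = x \<longrightarrow> y \<in> U)"

instance
proof
  have lim: "(\<lambda>n. proj_norm (s n)) \<longlonglongrightarrow> lim (\<lambda>n. proj_norm (s n))"
    if "proj_rel s s" for s :: "nat \<Rightarrow> ('a, 'b) tensor"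
    using that proj_norm_convergent convergent_LIMSEQ_iff unfolding proj_rel_def by blast
  fix u v w :: "('a, 'b) ptensor" and c d :: real
  show "u + v + w = u + (v + w)"
    by transfer (auto simp: algebra_simps intro!: proj_rel_refl proj_Cauchy_add
        simp: proj_rel_def)
  show "u + v = v + u"
    by transfer (auto simp: add.commute proj_rel_def intro!: proj_Cauchy_add)
  show "0 + u = u" by transfer simp
  show "- u + u = 0"
    unfolding uminus_ptensor_def by transfer (simp add: proj_rel_refl)
  show "u - v = u + - v" by (rule minus_ptensor_def)
  show "c *\<^sub>R (u + v) = c *\<^sub>R u + c *\<^sub>R v"
    by transfer (auto simp: scaleR_add_right proj_rel_def
        intro!: proj_Cauchy_add proj_Cauchy_scaleR)
  show "(c + d) *\<^sub>R u = c *\<^sub>R u + d *\<^sub>R u"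
    by transfer (auto simp: scaleR_add_left proj_rel_def
        intro!: proj_Cauchy_add proj_Cauchy_scaleR)
  show "c *\<^sub>R d *\<^sub>R u = (c * d) *\<^sub>R u"
    by transfer (auto simp: proj_rel_def intro!: proj_Cauchy_scaleR)
  show "1 *\<^sub>R u = u" by transfer simp
  show "dist u v = norm (u - v)" by (rule dist_ptensor_def)
  show "sgn u = inverse (norm u) *\<^sub>R u" by (rule sgn_ptensor_def)
  show "uniformity =
      (INF e\<in>{0<..}. principal {(x :: ('a, 'b) ptensor, y). dist x y < e})"
    by (rule uniformity_ptensor_def)
  show "open U = (\<forall>x\<in>U. \<forall>\<^sub>F (x', y) in uniformity. x' = x \<longrightarrow> y \<in> U)"
    for U :: "('a, 'b) ptensor set" by (rule open_ptensor_def)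
  show "norm u = 0 \<longleftrightarrow> u = 0"
  proof (transfer, safe)
    fix s :: "nat \<Rightarrow> ('a, 'b) tensor"
    assume s: "proj_rel s s" and "lim (\<lambda>n. proj_norm (s n)) = 0"
    then have "(\<lambda>n. proj_norm (s n)) \<longlonglongrightarrow> 0" using lim[OF s] by simp
    then show "proj_rel s (\<lambda>_. 0)" using s by (simp add: proj_rel_def)
  next
    fix s :: "nat \<Rightarrow> ('a, 'b) tensor"
    assume "proj_rel s (\<lambda>_. 0)"
    then show "lim (\<lambda>n. proj_norm (s n)) = 0" by (auto simp: proj_rel_def intro: limI)
  qed
  show "norm (u + v) \<le> norm u + norm v"
  proof transfer
    fix s t :: "nat \<Rightarrow> ('a, 'b) tensor"
    assume s: "proj_rel s s" and t: "proj_rel t t"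
    show "lim (\<lambda>n. proj_norm (s n + t n)) \<le>
        lim (\<lambda>n. proj_norm (s n)) + lim (\<lambda>n. proj_norm (t n))"
      by (rule LIMSEQ_le[OF lim[OF proj_rel_add[OF s t]] tendsto_add[OF lim[OF s] lim[OF t]]])
        (simp add: proj_norm_triangle)
  qed
  show "norm (c *\<^sub>R u) = \<bar>c\<bar> * norm u"
  proof transfer
    fix c :: real and s :: "nat \<Rightarrow> ('a, 'b) tensor"
    assume s: "proj_rel s s"
    show "lim (\<lambda>n. proj_norm (c *\<^sub>R s n)) = \<bar>c\<bar> * lim (\<lambda>n. proj_norm (s n))"
      unfolding proj_norm_scaleR by (intro limI tendsto_mult_left lim s)
  qed
qed

end

definition ptensor_of ::
    "('a::real_normed_vector, 'b::real_normed_vector) tensor \<Rightarrow> ('a, 'b) ptensor"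
  where "ptensor_of u = abs_ptensor (\<lambda>_. u)"

lemma norm_ptensor_of: "norm (ptensor_of u) = proj_norm u"
  by (simp add: ptensor_of_def norm_ptensor.abs_eq proj_rel_refl)

lemma ptensor_of_add: "ptensor_of (u + v) = ptensor_of u + ptensor_of v"
  by (simp add: ptensor_of_def plus_ptensor.abs_eq proj_rel_refl)

lemma ptensor_of_scaleR: "ptensor_of (c *\<^sub>R u) = c *\<^sub>R ptensor_of u"
  by (simp add: ptensor_of_def scaleR_ptensor.abs_eq proj_rel_refl)

lemma ptensor_of_zero: "ptensor_of 0 = 0"
  by (simp add: ptensor_of_def zero_ptensor_def)

lemma ptensor_of_diff: "ptensor_of (u - v) = ptensor_of u - ptensor_of v"
  using ptensor_of_add[of "u - v" v] by (simp add: algebra_simps)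

lemma ptensor_of_tendsto:
  assumes "proj_Cauchy s"
  shows "(\<lambda>n. ptensor_of (s n)) \<longlonglongrightarrow> abs_ptensor s"
proof (rule LIMSEQ_I)
  fix e :: real assume "0 < e"
  then obtain N where N: "\<And>m n. m \<ge> N \<Longrightarrow> n \<ge> N \<Longrightarrow> proj_norm (s m - s n) < e / 2"
    using assms unfolding proj_Cauchy_def by (meson half_gt_zero)
  have "norm (ptensor_of (s n) - abs_ptensor s) < e" if n: "n \<ge> N" for n
  proof -
    have c: "proj_Cauchy (\<lambda>m. s n + (-1) *\<^sub>R s m)"
      by (intro proj_Cauchy_add proj_Cauchy_const proj_Cauchy_scaleR assms)
    have "ptensor_of (s n) - abs_ptensor s = abs_ptensor (\<lambda>m. s n + (-1) *\<^sub>R s m)"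
      unfolding minus_ptensor_def uminus_ptensor_def ptensor_of_def
      by (simp only: plus_ptensor.abs_eq scaleR_ptensor.abs_eq proj_rel_refl proj_Cauchy_scaleR
          proj_Cauchy_const assms)
    then have eq: "norm (ptensor_of (s n) - abs_ptensor s) = lim (\<lambda>m. proj_norm (s n - s m))"
      using norm_ptensor.abs_eq[OF proj_rel_refl[OF c]] by simp
    have "(\<lambda>m. proj_norm (s n - s m)) \<longlonglongrightarrow> lim (\<lambda>m. proj_norm (s n - s m))"
      using proj_norm_convergent[OF c] by (simp add: convergent_LIMSEQ_iff)
    then have "lim (\<lambda>m. proj_norm (s n - s m)) \<le> e / 2"
      by (rule LIMSEQ_le_const2) (use N[OF n] in \<open>auto intro!: exI[of _ N] less_imp_le\<close>)
    then show ?thesis using eq \<open>0 < e\<close> by simp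
  qed
  then show "\<exists>N. \<forall>n\<ge>N. norm (ptensor_of (s n) - abs_ptensor s) < e" by blast
qed

lemma ptensor_cases:
  obtains s where "proj_Cauchy s" "z = abs_ptensor s"
  using Quotient_rep_reflp[OF Quotient_ptensor] Quotient_abs_rep[OF Quotient_ptensor]
  unfolding proj_rel_def by metis

lemma ptensor_of_dense:
  assumes "0 < e"
  obtains u where "norm (z - ptensor_of u) < e"
proof -
  obtain s where s: "proj_Cauchy s" "z = abs_ptensor s" by (rule ptensor_cases)
  from LIMSEQ_D[OF ptensor_of_tendsto[OF s(1)] assms]
  show ?thesis using that s(2) by (metis norm_minus_commute order_refl)
qed

instance ptensor :: (real_normed_vector, real_normed_vector) banach
proof
  fix X :: "nat \<Rightarrow> ('a, 'b) ptensor"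
  assume X: "Cauchy X"
  have "\<exists>u. norm (X n - ptensor_of u) < inverse (Suc n)" for n
    by (rule ptensor_of_dense[of "inverse (Suc n)" "X n"]) auto
  then obtain u where u: "\<And>n. norm (X n - ptensor_of (u n)) < inverse (Suc n)" by metis
  have diff: "(\<lambda>n. X n - ptensor_of (u n)) \<longlonglongrightarrow> 0"
    by (rule Lim_null_comparison[OF _ LIMSEQ_inverse_real_of_nat])
      (use u in \<open>auto intro!: always_eventually less_imp_le\<close>)
  have "Cauchy (\<lambda>n. ptensor_of (u n))"
  proof (rule CauchyI)
    fix e :: real assume "0 < e"
    obtain M where M: "\<And>m n. m \<ge> M \<Longrightarrow> n \<ge> M \<Longrightarrow> norm (X m - X n) < e / 3"
      using CauchyD[OF X, of "e / 3"] \<open>0 < e\<close> by auto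
    obtain N where N: "\<And>n. n \<ge> N \<Longrightarrow> norm (X n - ptensor_of (u n)) < e / 3"
      using LIMSEQ_D[OF diff, of "e / 3"] \<open>0 < e\<close> by auto
    have "norm (ptensor_of (u m) - ptensor_of (u n)) < e" if "m \<ge> max M N" "n \<ge> max M N" for m n
      using M[of m n] N[of m] N[of n] that
        norm_triangle_ineq4[of "X m - X n" "(X m - ptensor_of (u m)) - (X n - ptensor_of (u n))"]
        norm_triangle_ineq4[of "X m - ptensor_of (u m)" "X n - ptensor_of (u n)"]
      by (simp add: algebra_simps)
    then show "\<exists>M. \<forall>m\<ge>M. \<forall>n\<ge>M. norm (ptensor_of (u m) - ptensor_of (u n)) < e" by blast
  qed
  then have "proj_Cauchy u"
    by (simp add: Cauchy_iff proj_Cauchy_def norm_ptensor_of flip: ptensor_of_diff)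
  from tendsto_add[OF ptensor_of_tendsto[OF this] diff]
  show "convergent X" by (auto simp: convergent_def)
qed


section \<open>Operators into the dual as functionals on the projective tensor product\<close>

definition tensor_pair ::
    "('a::real_normed_vector \<Rightarrow>\<^sub>L ('b::real_normed_vector \<Rightarrow>\<^sub>L real)) \<Rightarrow> ('a, 'b) tensor \<Rightarrow> real"
  where "tensor_pair T u = tensor_apply u (\<lambda>x y. T x y)"

lemma bilinear_blinfun: "bilinear (\<lambda>x y. blinfun_apply (blinfun_apply T x) y)"
  by (auto simp: bilinear_def linear_iff blinfun.bilinear_simps)

lemma tensor_pair_elem [simp]: "tensor_pair T (elem_tensor x y) = T x y"
  by (simp add: tensor_pair_def elem_tensor.rep_eq bilinear_blinfun)

lemma tensor_pair_add: "tensor_pair T (u + v) = tensor_pair T u + tensor_pair T v"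
  by (simp add: tensor_pair_def plus_tensor.rep_eq)

lemma tensor_pair_scaleR: "tensor_pair T (c *\<^sub>R u) = c * tensor_pair T u"
  by (simp add: tensor_pair_def scaleR_tensor.rep_eq)

lemma tensor_pair_diff: "tensor_pair T (u - v) = tensor_pair T u - tensor_pair T v"
  using tensor_pair_add[of T "u - v" v] by simp

lemma tensor_pair_zero [simp]: "tensor_pair T 0 = 0"
  by (simp add: tensor_pair_def zero_tensor.rep_eq)

lemma tensor_pair_bound: "\<bar>tensor_pair T u\<bar> \<le> norm T * proj_norm u"
proof (cases "norm T = 0")
  case True
  obtain l where "u = (\<Sum>(x, y)\<leftarrow>l. elem_tensor x y)" by (rule tensor_cases)
  moreover have "tensor_pair T (\<Sum>(x, y)\<leftarrow>l. elem_tensor x y) = 0"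
    using True by (induction l) (auto simp: tensor_pair_add)
  ultimately show ?thesis by simp
next
  case False
  have "\<bar>tensor_pair T u\<bar> / norm T \<le> proj_norm u"
  proof (rule proj_norm_greatest)
    fix l assume u: "u = (\<Sum>(x, y)\<leftarrow>l. elem_tensor x y)"
    have "\<bar>tensor_pair T u\<bar> \<le> norm T * (\<Sum>(x, y)\<leftarrow>l. norm x * norm y)"
      unfolding u
    proof (induction l)
      case (Cons p l)
      obtain x y where p: "p = (x, y)" by force
      have "\<bar>T x y\<bar> \<le> norm (T x) * norm y" using norm_blinfun[of "T x" y] by simp
      also have "\<dots> \<le> norm T * norm x * norm y"
        by (intro mult_right_mono norm_blinfun) auto
      finally show ?case using Cons by (simp add: p tensor_pair_add algebra_simps)
    qed simp
    then show "\<bar>tensor_pair T u\<bar> / norm T \<le> (\<Sum>(x, y)\<leftarrow>l. norm x * norm y)"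
      using False by (simp add: divide_simps mult.commute)
  qed
  then show ?thesis using False by (simp add: divide_simps mult.commute)
qed

lemma tensor_pair_Cauchy:
  assumes "proj_Cauchy s"
  shows "Cauchy (\<lambda>n. tensor_pair T (s n))"
proof (rule metric_CauchyI)
  fix e :: real assume "0 < e"
  then have "0 < e / (norm T + 1)" by (simp add: add_nonneg_pos)
  then obtain N where N: "\<And>m n. m \<ge> N \<Longrightarrow> n \<ge> N \<Longrightarrow> proj_norm (s m - s n) < e / (norm T + 1)"
    using assms unfolding proj_Cauchy_def by meson
  have "dist (tensor_pair T (s m)) (tensor_pair T (s n)) < e" if "m \<ge> N" "n \<ge> N" for m n
  proof -
    have "dist (tensor_pair T (s m)) (tensor_pair T (s n)) \<le> norm T * proj_norm (s m - s n)"
      using tensor_pair_bound[of T "s m - s n"] by (simp add: dist_real_def tensor_pair_diff)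
    also have "\<dots> \<le> (norm T + 1) * proj_norm (s m - s n)"
      by (intro mult_right_mono) auto
    also have "\<dots> < e"
      using N[OF that] by (simp add: pos_less_divide_eq add_nonneg_pos mult.commute)
    finally show ?thesis .
  qed
  then show "\<exists>M. \<forall>m\<ge>M. \<forall>n\<ge>M. dist (tensor_pair T (s m)) (tensor_pair T (s n)) < e" by blast
qed

lemma tensor_pair_lim:
  "proj_Cauchy s \<Longrightarrow> (\<lambda>n. tensor_pair T (s n)) \<longlonglongrightarrow> lim (\<lambda>n. tensor_pair T (s n))"
  using tensor_pair_Cauchy Cauchy_convergent_iff convergent_LIMSEQ_iff by blast

lemma proj_rel_pair:
  assumes "proj_rel s t"
  shows "lim (\<lambda>n. tensor_pair T (s n)) = lim (\<lambda>n. tensor_pair T (t n))"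
proof (rule limI)
  have t: "(\<lambda>n. tensor_pair T (t n)) \<longlonglongrightarrow> lim (\<lambda>n. tensor_pair T (t n))"
    using assms tensor_pair_lim unfolding proj_rel_def by blast
  have "(\<lambda>n. norm T * proj_norm (s n - t n)) \<longlonglongrightarrow> 0"
    using assms by (auto simp: proj_rel_def intro!: tendsto_eq_intros)
  then have "(\<lambda>n. tensor_pair T (s n) - tensor_pair T (t n)) \<longlonglongrightarrow> 0"
    by (rule Lim_null_comparison[rotated])
      (simp add: tensor_pair_bound flip: tensor_pair_diff)
  from tendsto_add[OF this t]
  show "(\<lambda>n. tensor_pair T (s n)) \<longlonglongrightarrow> lim (\<lambda>n. tensor_pair T (t n))" by simp
qed

lift_definition ptensor_pair ::
    "('a::real_normed_vector \<Rightarrow>\<^sub>L ('b::real_normed_vector \<Rightarrow>\<^sub>L real)) \<Rightarrow> ('a, 'b) ptensor \<Rightarrow> real"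
  is "\<lambda>T s. lim (\<lambda>n. tensor_pair T (s n))"
  by (rule proj_rel_pair)

lemma bounded_linear_ptensor_pair:
  fixes T :: "'a::real_normed_vector \<Rightarrow>\<^sub>L ('b::real_normed_vector \<Rightarrow>\<^sub>L real)"
  shows "bounded_linear (ptensor_pair T)"
proof (rule bounded_linear_intro)
  fix z w :: "('a, 'b) ptensor" and c :: real
  show "ptensor_pair T (z + w) = ptensor_pair T z + ptensor_pair T w"
    by transfer (auto simp: proj_rel_def tensor_pair_add intro!: limI tendsto_add tensor_pair_lim)
  show "ptensor_pair T (c *\<^sub>R z) = c *\<^sub>R ptensor_pair T z"
    by transfer
      (auto simp: proj_rel_def tensor_pair_scaleR intro!: limI tendsto_mult_left tensor_pair_lim)
  show "norm (ptensor_pair T z) \<le> norm z * norm T"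
  proof -
    obtain s where s: "proj_Cauchy s" "z = abs_ptensor s" by (rule ptensor_cases)
    have "(\<lambda>n. proj_norm (s n)) \<longlonglongrightarrow> lim (\<lambda>n. proj_norm (s n))"
      using proj_norm_convergent[OF s(1)] by (simp add: convergent_LIMSEQ_iff)
    moreover have "norm (tensor_pair T (s n)) \<le> proj_norm (s n) * norm T" for n
      using tensor_pair_bound[of T "s n"] by (simp add: mult.commute)
    ultimately have "norm (lim (\<lambda>n. tensor_pair T (s n))) \<le> lim (\<lambda>n. proj_norm (s n)) * norm T"
      by (intro LIMSEQ_le[OF tendsto_norm[OF tensor_pair_lim[OF s(1)]] tendsto_mult_right])
        auto
    then show ?thesis
      using s by (simp add: ptensor_pair.abs_eq norm_ptensor.abs_eq proj_rel_refl)
  qed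
qed

text \<open>The identification of \<open>\<L>(X, Y\<^sup>*)\<close> with the dual of the projective tensor product,
  determined by \<open>T (x \<otimes> y) = (T x) y\<close>.\<close>

definition ptensor_dual ::
    "('a::real_normed_vector \<Rightarrow>\<^sub>L ('b::real_normed_vector \<Rightarrow>\<^sub>L real)) \<Rightarrow> (('a, 'b) ptensor \<Rightarrow>\<^sub>L real)"
  where "ptensor_dual T = Blinfun (ptensor_pair T)"

lemma ptensor_dual_apply: "blinfun_apply (ptensor_dual T) z = ptensor_pair T z"
  by (simp add: ptensor_dual_def bounded_linear_Blinfun_apply bounded_linear_ptensor_pair)

lemma ptensor_dual_of: "ptensor_dual T (ptensor_of u) = tensor_pair T u"
  by (simp add: ptensor_dual_apply ptensor_of_def ptensor_pair.abs_eq proj_rel_refl)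

lemma ptensor_dual_elem: "ptensor_dual T (ptensor_of (elem_tensor x y)) = T x y"
  by (simp add: ptensor_dual_of)

lemma ptensor_dual_eqI:
  assumes "\<And>x y. blinfun_apply f (ptensor_of (elem_tensor x y)) =
    blinfun_apply g (ptensor_of (elem_tensor x y))"
  shows "f = g"
proof (rule blinfun_eqI)
  fix z :: "('a, 'b) ptensor"
  have of: "f (ptensor_of u) = g (ptensor_of u)" for u
  proof -
    obtain l where "u = (\<Sum>(x, y)\<leftarrow>l. elem_tensor x y)" by (rule tensor_cases)
    moreover have "f (ptensor_of (\<Sum>(x, y)\<leftarrow>l. elem_tensor x y)) =
        g (ptensor_of (\<Sum>(x, y)\<leftarrow>l. elem_tensor x y))"
      by (induction l)
        (auto simp: ptensor_of_zero ptensor_of_add blinfun.bilinear_simps assms)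
    ultimately show ?thesis by simp
  qed
  obtain s where s: "proj_Cauchy s" "z = abs_ptensor s" by (rule ptensor_cases)
  have z: "(\<lambda>n. ptensor_of (s n)) \<longlonglongrightarrow> z" using s ptensor_of_tendsto by blast
  have f: "(\<lambda>n. f (ptensor_of (s n))) \<longlonglongrightarrow> f z" and g: "(\<lambda>n. g (ptensor_of (s n))) \<longlonglongrightarrow> g z"
    by (intro blinfun.tendsto tendsto_const z)+
  show "f z = g z" using LIMSEQ_unique[OF f[unfolded of] g] .
qed

lemma linear_ptensor_dual: "linear ptensor_dual"
  by (rule linearI; rule ptensor_dual_eqI)
    (simp_all add: ptensor_dual_elem blinfun.bilinear_simps)

lemma norm_ptensor_dual: "norm (ptensor_dual T) = norm T"
proof (rule antisym)
  show "norm (ptensor_dual T) \<le> norm T"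
  proof (rule norm_blinfun_bound)
    fix z :: "('a, 'b) ptensor"
    obtain s where s: "proj_Cauchy s" "z = abs_ptensor s" by (rule ptensor_cases)
    have z: "(\<lambda>n. ptensor_of (s n)) \<longlonglongrightarrow> z" using s ptensor_of_tendsto by blast
    show "norm (ptensor_dual T z) \<le> norm T * norm z"
      by (rule LIMSEQ_le[OF tendsto_norm[OF blinfun.tendsto[OF tendsto_const z]]
            tendsto_mult_left[OF tendsto_norm[OF z]]])
        (simp add: ptensor_dual_of norm_ptensor_of tensor_pair_bound)
  qed simp
  show "norm T \<le> norm (ptensor_dual T)"
  proof (rule norm_blinfun_bound)
    fix x
    show "norm (T x) \<le> norm (ptensor_dual T) * norm x"
    proof (rule norm_blinfun_bound)
      fix y
      have "norm (T x y) \<le> norm (ptensor_dual T) * norm (ptensor_of (elem_tensor x y))"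
        using norm_blinfun[of "ptensor_dual T" "ptensor_of (elem_tensor x y)"]
        by (simp add: ptensor_dual_elem)
      also have "\<dots> \<le> norm (ptensor_dual T) * (norm x * norm y)"
        using proj_norm_le[of "[(x, y)]"] by (intro mult_left_mono) (auto simp: norm_ptensor_of)
      finally show "norm (T x y) \<le> norm (ptensor_dual T) * norm x * norm y"
        by (simp add: mult.assoc)
    qed simp
  qed simp
qed

lemma surj_ptensor_dual:
  "surj (ptensor_dual :: ('a::real_normed_vector \<Rightarrow>\<^sub>L ('b::real_normed_vector \<Rightarrow>\<^sub>L real)) \<Rightarrow> _)"
  unfolding surj_def
proof (rule allI)
  fix f :: "('a, 'b) ptensor \<Rightarrow>\<^sub>L real"
  let ?b = "\<lambda>x y. f (ptensor_of (elem_tensor x y))"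
  let ?T = "Blinfun (\<lambda>x. Blinfun (?b x))"
  have add: "?b (x + x') y = ?b x y + ?b x' y" "?b x (y + y') = ?b x y + ?b x y'"
    and scale: "?b (c *\<^sub>R x) y = c *\<^sub>R ?b x y" "?b x (c *\<^sub>R y) = c *\<^sub>R ?b x y" for x x' y y' c
    by (simp_all add: elem_tensor_add_left elem_tensor_add_right elem_tensor_scaleR_left
        elem_tensor_scaleR_right ptensor_of_add ptensor_of_scaleR blinfun.bilinear_simps)
  have bound: "norm (?b x y) \<le> norm f * norm x * norm y" for x y
  proof -
    have "norm (?b x y) \<le> norm f * norm (ptensor_of (elem_tensor x y))"
      by (rule norm_blinfun)
    also have "\<dots> \<le> norm f * (norm x * norm y)"
      using proj_norm_le[of "[(x, y)]"] by (intro mult_left_mono) (auto simp: norm_ptensor_of)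
    finally show ?thesis by (simp add: mult.assoc)
  qed
  have bl: "bounded_linear (?b x)" for x
    by (rule bounded_linear_intro[of _ "norm f * norm x"])
      (simp_all only: add scale, use bound[of x] in \<open>simp add: mult.commute\<close>)
  have ap: "Blinfun (?b x) y = ?b x y" for x y
    by (rule bounded_linear_Blinfun_apply[OF bl, THEN fun_cong])
  have "bounded_linear (\<lambda>x. Blinfun (?b x))"
  proof (rule bounded_linear_intro[of _ "norm f"])
    show "Blinfun (?b (x + x')) = Blinfun (?b x) + Blinfun (?b x')" for x x'
      by (rule blinfun_eqI) (unfold blinfun.add_left ap, rule add)
    show "Blinfun (?b (c *\<^sub>R x)) = c *\<^sub>R Blinfun (?b x)" for c x
      by (rule blinfun_eqI) (unfold blinfun.scaleR_left ap, rule scale)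
    show "norm (Blinfun (?b x)) \<le> norm x * norm f" for x
      by (rule norm_blinfun_bound)
        (use bound[of x] in \<open>simp_all add: ap mult.commute\<close>)
  qed
  then have "f = ptensor_dual ?T"
    by (intro ptensor_dual_eqI) (simp add: ptensor_dual_elem bounded_linear_Blinfun_apply ap)
  then show "\<exists>T. f = ptensor_dual T" ..
qed

lemma bounded_linear_ptensor_dual: "bounded_linear ptensor_dual"
  by (rule bounded_linear_intro[of _ 1])
    (simp_all add: linear_add linear_scale linear_ptensor_dual norm_ptensor_dual)


section \<open>Weak topology and weak$^*$-strongly extreme points\<close>

definition weak_topology :: "'w::real_normed_vector topology"
  where "weak_topology =
    topology_generated_by {blinfun_apply f -` U | (f :: 'w \<Rightarrow>\<^sub>L real) U. open U}"

text \<open>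
  A dual space \<open>'w\<close> with predual \<open>'z\<close> is given by its identification
  \<open>J :: 'w \<Rightarrow> ('z \<Rightarrow>\<^sub>L real)\<close> with the dual of \<open>'z\<close>: \<open>J\<close> is the identity for \<open>'w = ('z \<Rightarrow>\<^sub>L real)\<close>,
  and \<open>ptensor_dual\<close> for operators into a dual.
\<close>

definition weak_star_slice ::
    "('w::real_normed_vector \<Rightarrow> ('z::real_normed_vector \<Rightarrow>\<^sub>L real)) \<Rightarrow> 'z \<Rightarrow> real \<Rightarrow> 'w set"
  where "weak_star_slice J z \<alpha> =
    {f \<in> cball 0 1. blinfun_apply (J f) z > (SUP g\<in>cball 0 1. blinfun_apply (J g) z) - \<alpha>}"

lemma openin_weak_star_slice:
  assumes "bounded_linear J"
  shows "openin (subtopology weak_topology (cball 0 1)) (weak_star_slice J z \<alpha>)"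
proof -
  define c where "c = (SUP g\<in>cball 0 1. blinfun_apply (J g) z) - \<alpha>"
  define h where "h = Blinfun (\<lambda>f. blinfun_apply (J f) z)"
  have h: "blinfun_apply h f = J f z" for f
    unfolding h_def
    by (intro bounded_linear_Blinfun_apply[THEN fun_cong]
        bounded_linear_compose[OF blinfun.bounded_linear_left assms])
  have "openin weak_topology (h -` {c<..})"
    unfolding weak_topology_def by (rule topology_generated_by_Basis) (use open_greaterThan in blast)
  moreover have "weak_star_slice J z \<alpha> = h -` {c<..} \<inter> cball 0 1"
    by (auto simp: weak_star_slice_def c_def h)
  ultimately show ?thesis by (auto simp: openin_subtopology)
qed

text \<open>
  The slices containing \<open>f\<close> form a local base at \<open>f\<close>: since slices are relatively weakly open, this
  says exactly that every relatively weakly open set containing \<open>f\<close> contains a slice containing \<open>f\<close>.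
\<close>

definition weak_star_strongly_extreme ::
    "('w::real_normed_vector \<Rightarrow> ('z::real_normed_vector \<Rightarrow>\<^sub>L real)) \<Rightarrow> 'w \<Rightarrow> bool"
  where "weak_star_strongly_extreme J f \<longleftrightarrow>
    f \<in> sphere 0 1 \<and>
    neighbourhood_base_at f (\<lambda>S. \<exists>z \<alpha>. \<alpha> > 0 \<and> S = weak_star_slice J z \<alpha> \<and> f \<in> S)
      (subtopology weak_topology (cball 0 1))"

lemma weak_star_strongly_extreme_iff:
  assumes "bounded_linear J"
  shows "weak_star_strongly_extreme J f \<longleftrightarrow> norm f = 1 \<and>
    (\<forall>W. openin (subtopology weak_topology (cball 0 1)) W \<and> f \<in> W \<longrightarrow>
      (\<exists>z \<alpha>. \<alpha> > 0 \<and> f \<in> weak_star_slice J z \<alpha> \<and> weak_star_slice J z \<alpha> \<subseteq> W))"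
proof -
  let ?X = "subtopology weak_topology (cball 0 1)"
  let ?P = "\<lambda>S. \<exists>z \<alpha>. \<alpha> > 0 \<and> S = weak_star_slice J z \<alpha> \<and> f \<in> S"
  have "neighbourhood_base_at f ?P ?X \<longleftrightarrow> (\<forall>W. openin ?X W \<and> f \<in> W \<longrightarrow> (\<exists>S. ?P S \<and> S \<subseteq> W))"
    unfolding neighbourhood_base_at_def
    by (metis openin_weak_star_slice[OF assms] subset_refl)
  also have "\<dots> \<longleftrightarrow> (\<forall>W. openin ?X W \<and> f \<in> W \<longrightarrow>
      (\<exists>z \<alpha>. \<alpha> > 0 \<and> f \<in> weak_star_slice J z \<alpha> \<and> weak_star_slice J z \<alpha> \<subseteq> W))"
    by metis
  finally show ?thesis
    unfolding weak_star_strongly_extreme_def mem_sphere_0 by (rule conj_cong[OF refl])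
qed

definition rank_one_op ::
    "('a::real_normed_vector \<Rightarrow>\<^sub>L real) \<Rightarrow> 'b::real_normed_vector \<Rightarrow> ('a \<Rightarrow>\<^sub>L 'b)"
  where "rank_one_op f v = blinfun_scaleR_left v o\<^sub>L f"

lemma rank_one_op_apply: "rank_one_op f v x = f x *\<^sub>R v"
  by (simp add: rank_one_op_def)

end

theory Submission
  imports Defs
begin

text \<open>
  The ball of \<open>X\<^sup>*\<close> sits inside the ball of \<open>\<L>(X, Y\<^sup>*)\<close> through the isometry \<open>f \<mapsto> f \<otimes> y\<^sub>0\<close>, and both
  topologies in the definition of a weak\<open>\<^sup>*\<close>-strongly extreme point restrict well along it.

  \<^item> The isometry is weak\<open>\<^sup>*\<close>-continuous: it is the adjoint of the operator from the projective tensor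
    product to \<open>X\<close> that sends \<open>x \<otimes> y\<close> to \<open>y\<^sub>0(y) x\<close>.  If this operator maps \<open>u\<close> to \<open>z\<close>, the trace on
    the ball of \<open>X\<^sup>*\<close> of a slice given by \<open>u\<close> is cut out by an inequality \<open>f(z) > c\<close>.  When it is
    nonempty, it is therefore itself a slice, given by \<open>z\<close>
    (\<open>ptensor_dual_bilinear_image\<close>, \<open>weak_star_slice_halfspace\<close>).

  \<^item> The isometry has a bounded linear left inverse \<open>S \<mapsto> (x \<mapsto> (S x)(b))\<close>, where \<open>y\<^sub>0(b) = 1\<close>.  Bounded
    linear maps are weak-to-weak continuous, so every weak neighbourhood of \<open>x\<^sub>0\<close> is the trace of a
    weak neighbourhood of \<open>x\<^sub>0 \<otimes> y\<^sub>0\<close> (\<open>continuous_map_weak_topology\<close>).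

  A slice around \<open>x\<^sub>0 \<otimes> y\<^sub>0\<close> inside the latter neighbourhood then restricts to a slice around \<open>x\<^sub>0\<close>
  inside the former one; \<open>weak_star_strongly_extreme_pullback\<close> carries out this step for any
  contraction with these two properties.  The other factor is treated in the same way, with
  \<open>x \<otimes> y \<mapsto> x\<^sub>0(x) y\<close> and \<open>S \<mapsto> S a\<close>, where \<open>x\<^sub>0(a) = 1\<close>.
\<close>

section \<open>Weak topologies and slices under bounded linear maps\<close>

lemma topspace_weak_topology [simp]: "topspace (weak_topology :: 'w::real_normed_vector topology) = UNIV"
proof -
  have "UNIV \<in> {blinfun_apply f -` U | (f :: 'w \<Rightarrow>\<^sub>L real) U. open U}"
    by (auto intro!: exI[of _ UNIV])
  then show ?thesis
    unfolding weak_topology_def topology_generated_by_topspace by blast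
qed

lemma continuous_map_weak_topology:
  fixes P :: "'v::real_normed_vector \<Rightarrow> 'w::real_normed_vector"
  assumes "bounded_linear P"
  shows "continuous_map weak_topology weak_topology P"
proof -
  have preimage: "openin weak_topology (P -` blinfun_apply f -` V)" if "open V"
    for f :: "'w \<Rightarrow>\<^sub>L real" and V
  proof -
    have "bounded_linear (\<lambda>v. f (P v))"
      by (intro bounded_linear_compose[OF blinfun.bounded_linear_right assms])
    then have "P -` blinfun_apply f -` V = blinfun_apply (Blinfun (\<lambda>v. f (P v))) -` V"
      by (simp add: bounded_linear_Blinfun_apply vimage_def)
    then show ?thesis
      unfolding weak_topology_def using that
      by (intro topology_generated_by_Basis CollectI exI conjI)
  qed
  show ?thesis
    unfolding weak_topology_def[where 'w='w]
  proof (rule continuous_on_generated_topo)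
    fix U assume "U \<in> {blinfun_apply f -` U | (f :: 'w \<Rightarrow>\<^sub>L real) U. open U}"
    then show "openin weak_topology (P -` U \<inter> topspace weak_topology)"
      using preimage by (elim CollectE exE conjE) (simp only: topspace_weak_topology Int_UNIV_right)
  next
    show "P ` topspace weak_topology
        \<subseteq> \<Union> {blinfun_apply f -` U | (f :: 'w \<Rightarrow>\<^sub>L real) U. open U}"
      unfolding topology_generated_by_topspace[symmetric] weak_topology_def[symmetric]
        topspace_weak_topology by (rule subset_UNIV)
  qed
qed

text \<open>
  The parameter of a slice is measured from the supremum over the ball, so a half-space with
  threshold \<open>c\<close> is a slice as soon as \<open>c\<close> lies below that supremum; a single point of the ball in
  the half-space guarantees this.
\<close>

lemma weak_star_slice_halfspace:
  fixes f0 :: "'z::real_normed_vector \<Rightarrow>\<^sub>L real"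
  assumes "norm f0 \<le> 1" "c < f0 z"
  obtains \<alpha> where "\<alpha> > 0" "weak_star_slice (\<lambda>f :: 'z \<Rightarrow>\<^sub>L real. f) z \<alpha> = {f \<in> cball 0 1. c < blinfun_apply f z}"
proof -
  let ?m = "SUP g\<in>cball 0 1. blinfun_apply (g :: 'z \<Rightarrow>\<^sub>L real) z"
  have "bdd_above ((\<lambda>g :: 'z \<Rightarrow>\<^sub>L real. g z) ` cball 0 1)"
  proof (rule bdd_aboveI2)
    fix g :: "'z \<Rightarrow>\<^sub>L real" assume "g \<in> cball 0 1"
    then have "norm g * norm z \<le> norm z" by (simp add: mult_left_le_one_le)
    then show "g z \<le> norm z" using norm_blinfun[of g z] by simp
  qed
  then have "f0 z \<le> ?m"
    using assms(1) by (intro cSUP_upper) auto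
  then show ?thesis
    using assms(2) by (intro that[of "?m - c"]) (auto simp: weak_star_slice_def)
qed

text \<open>
  The assumption \<open>predual\<close> says that \<open>E\<close> is the adjoint of a map \<open>u \<mapsto> z\<close> between the preduals.
  Weakly open subsets of the dual of \<open>'z\<close> are pulled back along \<open>P\<close>, and slices of the ball of \<open>'w\<close>
  are pulled back along \<open>E\<close>.
\<close>

lemma weak_star_strongly_extreme_pullback:
  fixes J :: "'w::real_normed_vector \<Rightarrow> ('u::real_normed_vector \<Rightarrow>\<^sub>L real)"
    and E :: "('z::real_normed_vector \<Rightarrow>\<^sub>L real) \<Rightarrow> 'w"
    and P :: "'w \<Rightarrow> ('z \<Rightarrow>\<^sub>L real)"
  assumes J: "bounded_linear J" and P: "bounded_linear P"
    and predual: "\<And>u. \<exists>z. \<forall>f. blinfun_apply (J (E f)) u = blinfun_apply f z"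
    and norm_E: "\<And>f. norm (E f) \<le> norm f"
    and P_E: "\<And>f. P (E f) = f"
    and "norm f0 = 1"
    and extreme: "weak_star_strongly_extreme J (E f0)"
  shows "weak_star_strongly_extreme (\<lambda>f :: 'z \<Rightarrow>\<^sub>L real. f) f0"
  unfolding weak_star_strongly_extreme_iff[OF bounded_linear_ident]
proof (intro conjI allI impI)
  show "norm f0 = 1" by fact
  fix W :: "('z \<Rightarrow>\<^sub>L real) set"
  assume "openin (subtopology weak_topology (cball 0 1)) W \<and> f0 \<in> W"
  then obtain U where U: "openin weak_topology U" "W = U \<inter> cball 0 1" "f0 \<in> U"
    by (auto simp: openin_subtopology)
  let ?V = "{S \<in> topspace weak_topology. P S \<in> U} \<inter> cball 0 1"
  have "openin (subtopology weak_topology (cball 0 1)) ?V"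
    unfolding openin_subtopology
    using openin_continuous_map_preimage[OF continuous_map_weak_topology[OF P] U(1)] by blast
  moreover have "E f0 \<in> ?V"
    using norm_E[of f0] \<open>norm f0 = 1\<close> U(3) by (simp add: P_E)
  ultimately obtain u \<beta> where u: "E f0 \<in> weak_star_slice J u \<beta>" "weak_star_slice J u \<beta> \<subseteq> ?V"
    using extreme[unfolded weak_star_strongly_extreme_iff[OF J], THEN conjunct2, rule_format, of ?V]
    by auto
  \<comment> \<open>The supremum over the ball of \<open>'w\<close> may exceed the one over the ball of \<open>'z \<Rightarrow>\<^sub>L real\<close>; hence the
    threshold itself is kept and the slice parameter is chosen anew.\<close>
  let ?c = "(SUP S\<in>cball 0 1. blinfun_apply (J S) u) - \<beta>"
  obtain z where z: "\<And>f. J (E f) u = f z" using predual by blast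
  have "?c < f0 z" using u(1) by (simp add: weak_star_slice_def z)
  have "norm f0 \<le> 1" using \<open>norm f0 = 1\<close> by simp
  obtain \<alpha> where \<alpha>: "\<alpha> > 0"
      "weak_star_slice (\<lambda>f :: 'z \<Rightarrow>\<^sub>L real. f) z \<alpha> = {f \<in> cball 0 1. ?c < blinfun_apply f z}"
    by (rule weak_star_slice_halfspace[OF \<open>norm f0 \<le> 1\<close> \<open>?c < f0 z\<close>])
  have "f \<in> W" if "norm f \<le> 1" "?c < f z" for f :: "'z \<Rightarrow>\<^sub>L real"
  proof -
    have "E f \<in> weak_star_slice J u \<beta>"
      using that norm_E[of f] by (simp add: weak_star_slice_def z)
    then have "P (E f) \<in> U" using u(2) by blast
    then show ?thesis using that(1) by (simp add: P_E U(2))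
  qed
  then show "\<exists>z \<alpha>. \<alpha> > 0 \<and> f0 \<in> weak_star_slice (\<lambda>f. f) z \<alpha> \<and> weak_star_slice (\<lambda>f. f) z \<alpha> \<subseteq> W"
    using \<open>norm f0 \<le> 1\<close> \<open>?c < f0 z\<close>
    by (intro exI[of _ z] exI[of _ \<alpha>] conjI \<alpha>(1)) (auto simp: \<alpha>(2))
qed


section \<open>Bounded bilinear maps on the projective tensor product\<close>

text \<open>
  Equality of tensors is equality on all scalar bilinear forms, bounded or not.  Since the linear
  functionals on a vector space, continuous or not, separate its points, composing \<open>B\<close> with them
  carries well-definedness over to vector-valued bilinear maps.
\<close>

lemma bilinear_sum_list_cong_tensor:
  fixes B :: "'a::real_normed_vector \<Rightarrow> 'b::real_normed_vector \<Rightarrow> 'c::real_vector"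
  assumes B: "bilinear B"
    and eq: "(\<Sum>(x, y)\<leftarrow>l. elem_tensor x y) = (\<Sum>(x, y)\<leftarrow>k. elem_tensor x y)"
  shows "(\<Sum>(x, y)\<leftarrow>l. B x y) = (\<Sum>(x, y)\<leftarrow>k. B x y)"
proof (rule ccontr)
  let ?v = "(\<Sum>(x, y)\<leftarrow>l. B x y) - (\<Sum>(x, y)\<leftarrow>k. B x y)"
  assume "\<not> ?thesis"
  then have "independent {?v}" by simp
  then obtain g :: "'c \<Rightarrow> real" where g: "linear g" "g ?v = 1"
    using linear_independent_extend[of "{?v}" "\<lambda>_. 1 :: real"] by auto
  have bil: "bilinear (\<lambda>x y. g (B x y))"
    using B g(1) by (auto simp: bilinear_def linear_iff)
  have "g (\<Sum>(x, y)\<leftarrow>m. B x y) = (\<Sum>(x, y)\<leftarrow>m. g (B x y))" for m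
    by (induction m) (auto simp: linear_0[OF g(1)] linear_add[OF g(1)])
  then have "g (\<Sum>(x, y)\<leftarrow>m. B x y) =
      tensor_apply (\<Sum>(x, y)\<leftarrow>m. elem_tensor x y) (\<lambda>x y. g (B x y))" for m
    using bil by (simp add: tensor_apply_sum_list)
  then have "g ?v = 0" by (simp add: linear_diff[OF g(1)] eq)
  then show False using g(2) by simp
qed

text \<open>
  The bound on \<open>L\<close> is stated for differences because it is used to transport Cauchy sequences.
\<close>

lemma bounded_bilinear_tensor_lift:
  fixes B :: "'a::real_normed_vector \<Rightarrow> 'b::real_normed_vector \<Rightarrow> 'c::real_normed_vector"
  assumes "bounded_bilinear B"
  obtains L :: "('a, 'b) tensor \<Rightarrow> 'c" and K
  where "\<And>l. L (\<Sum>(x, y)\<leftarrow>l. elem_tensor x y) = (\<Sum>(x, y)\<leftarrow>l. B x y)"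
    "\<And>u v. norm (L u - L v) \<le> K * proj_norm (u - v)" "K > 0"
proof -
  interpret B: bounded_bilinear B by fact
  have bil: "bilinear B"
    by (auto simp: bilinear_def linear_iff B.add_left B.add_right B.scaleR_left B.scaleR_right)
  obtain K where K: "K > 0" "\<And>x y. norm (B x y) \<le> norm x * norm y * K"
    using B.pos_bounded by blast
  define L where "L u = (\<Sum>(x, y)\<leftarrow>(SOME l. u = (\<Sum>(x, y)\<leftarrow>l. elem_tensor x y)). B x y)" for u
  have L: "L (\<Sum>(x, y)\<leftarrow>l. elem_tensor x y) = (\<Sum>(x, y)\<leftarrow>l. B x y)" for l
    unfolding L_def
    by (rule bilinear_sum_list_cong_tensor[OF bil, symmetric]) (rule someI, rule refl)
  have bound: "norm (L u) \<le> K * proj_norm u" for u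
  proof -
    have "norm (L u) / K \<le> proj_norm u"
    proof (rule proj_norm_greatest)
      fix l assume u: "u = (\<Sum>(x, y)\<leftarrow>l. elem_tensor x y)"
      have "norm (\<Sum>(x, y)\<leftarrow>l. B x y) \<le> K * (\<Sum>(x, y)\<leftarrow>l. norm x * norm y)"
      proof (induction l)
        case (Cons p l)
        obtain x y where p: "p = (x, y)" by force
        show ?case
          using Cons K(2)[of x y] norm_triangle_ineq[of "B x y" "\<Sum>(x, y)\<leftarrow>l. B x y"]
          by (simp add: p algebra_simps)
      qed simp
      then show "norm (L u) / K \<le> (\<Sum>(x, y)\<leftarrow>l. norm x * norm y)"
        using K(1) by (simp add: u L divide_simps mult.commute)
    qed
    then show ?thesis using K(1) by (simp add: divide_simps mult.commute)
  qed
  have add: "L (u + v) = L u + L v" for u v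
  proof -
    obtain l where u: "u = (\<Sum>(x, y)\<leftarrow>l. elem_tensor x y)" by (rule tensor_cases)
    obtain k where v: "v = (\<Sum>(x, y)\<leftarrow>k. elem_tensor x y)" by (rule tensor_cases)
    show ?thesis using L[of "l @ k"] by (simp add: u v L)
  qed
  have "L u - L v = L (u - v)" for u v
    using add[of "u - v" v] by simp
  then have "norm (L u - L v) \<le> K * proj_norm (u - v)" for u v
    using bound by simp
  then show ?thesis using that L K(1) by blast
qed

text \<open>
  The point \<open>z\<close> is the image of \<open>u\<close> under the operator on the projective tensor product induced by
  \<open>B\<close>.  It is obtained as the limit of the images of a Cauchy sequence of tensors
  representing \<open>u\<close>, which is where completeness of the target enters.
\<close>

lemma ptensor_dual_bilinear_image:
  fixes B :: "'a::real_normed_vector \<Rightarrow> 'b::real_normed_vector \<Rightarrow> 'c::banach"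
    and E :: "('c \<Rightarrow>\<^sub>L real) \<Rightarrow> ('a \<Rightarrow>\<^sub>L ('b \<Rightarrow>\<^sub>L real))"
  assumes "bounded_bilinear B" and E: "\<And>f x y. E f x y = f (B x y)"
  shows "\<exists>z. \<forall>f. ptensor_dual (E f) u = f z"
proof -
  obtain L K where L: "\<And>l. L (\<Sum>(x, y)\<leftarrow>l. elem_tensor x y) = (\<Sum>(x, y)\<leftarrow>l. B x y)"
    and K: "\<And>u v. norm (L u - L v) \<le> K * proj_norm (u - v)" "K > 0"
    using bounded_bilinear_tensor_lift[OF assms(1)] by metis
  have pair: "tensor_pair (E f) t = f (L t)" for f t
  proof -
    obtain l where t: "t = (\<Sum>(x, y)\<leftarrow>l. elem_tensor x y)" by (rule tensor_cases)
    have "tensor_pair (E f) (\<Sum>(x, y)\<leftarrow>l. elem_tensor x y) = f (\<Sum>(x, y)\<leftarrow>l. B x y)"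
      by (induction l) (auto simp: tensor_pair_add E blinfun.bilinear_simps)
    then show ?thesis by (simp add: t L)
  qed
  obtain s where s: "proj_Cauchy s" "u = abs_ptensor s" by (rule ptensor_cases)
  have "Cauchy (\<lambda>n. L (s n))"
  proof (rule CauchyI)
    fix e :: real assume "0 < e"
    then have "0 < e / K" using K(2) by simp
    then obtain N where N: "\<And>m n. m \<ge> N \<Longrightarrow> n \<ge> N \<Longrightarrow> proj_norm (s m - s n) < e / K"
      using s(1) unfolding proj_Cauchy_def by meson
    have "norm (L (s m) - L (s n)) < e" if "m \<ge> N" "n \<ge> N" for m n
      using N[OF that] K(1)[of "s m" "s n"] K(2) by (simp add: field_simps)
    then show "\<exists>M. \<forall>m\<ge>M. \<forall>n\<ge>M. norm (L (s m) - L (s n)) < e" by blast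
  qed
  then obtain z where z: "(\<lambda>n. L (s n)) \<longlonglongrightarrow> z"
    using Cauchy_convergent_iff convergent_def by blast
  have "ptensor_dual (E f) u = f z" for f
  proof (rule LIMSEQ_unique)
    have "(\<lambda>n. ptensor_dual (E f) (ptensor_of (s n))) \<longlonglongrightarrow> ptensor_dual (E f) u"
      unfolding s(2) by (intro blinfun.tendsto tendsto_const ptensor_of_tendsto s(1))
    then show "(\<lambda>n. f (L (s n))) \<longlonglongrightarrow> ptensor_dual (E f) u"
      by (simp add: ptensor_dual_of pair)
    show "(\<lambda>n. f (L (s n))) \<longlonglongrightarrow> f z"
      by (intro blinfun.tendsto tendsto_const z)
  qed
  then show ?thesis by blast
qed


section \<open>The factors of a rank one operator\<close>

lemma norm_rank_one_op_le: "norm (rank_one_op f v) \<le> norm f * norm v"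
proof (rule norm_blinfun_bound)
  fix x
  show "norm (rank_one_op f v x) \<le> norm f * norm v * norm x"
    using mult_right_mono[OF norm_blinfun[of f x], of "norm v"]
    by (simp add: rank_one_op_apply algebra_simps)
qed simp

lemma nonzero_blinfun_value_one:
  fixes f :: "'a::real_normed_vector \<Rightarrow>\<^sub>L real"
  assumes "f \<noteq> 0"
  obtains x where "f x = 1"
proof -
  obtain x where "f x \<noteq> 0" using assms by (metis blinfun_eqI zero_blinfun.rep_eq)
  then have "f ((1 / f x) *\<^sub>R x) = 1" by (simp add: blinfun.scaleR_right)
  then show ?thesis by (rule that)
qed

theorem corollary2p2:
  fixes x0 :: "'a::banach \<Rightarrow>\<^sub>L real" and y0 :: "'b::banach \<Rightarrow>\<^sub>L real"
  assumes "x0 \<in> sphere 0 1" and "y0 \<in> sphere 0 1"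
    and "weak_star_strongly_extreme ptensor_dual (rank_one_op x0 y0)"
  shows "weak_star_strongly_extreme (\<lambda>f :: 'a \<Rightarrow>\<^sub>L real. f) x0 \<and>
    weak_star_strongly_extreme (\<lambda>g :: 'b \<Rightarrow>\<^sub>L real. g) y0"
proof
  have norm: "norm x0 = 1" "norm y0 = 1" using assms(1,2) by auto
  then have "x0 \<noteq> 0" "y0 \<noteq> 0" by auto
  then obtain a b where a: "x0 a = 1" and b: "y0 b = 1"
    using nonzero_blinfun_value_one by metis
  define ev where "ev = Blinfun (\<lambda>g :: 'b \<Rightarrow>\<^sub>L real. g b)"
  have ev: "ev g = g b" for g
    by (simp add: ev_def bounded_linear_Blinfun_apply blinfun.bounded_linear_left)
  show "weak_star_strongly_extreme (\<lambda>f :: 'a \<Rightarrow>\<^sub>L real. f) x0"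
  proof (rule weak_star_strongly_extreme_pullback[OF bounded_linear_ptensor_dual,
        where E = "\<lambda>f. rank_one_op f y0" and P = "\<lambda>S. ev o\<^sub>L S"])
    show "bounded_linear (\<lambda>S :: 'a \<Rightarrow>\<^sub>L ('b \<Rightarrow>\<^sub>L real). ev o\<^sub>L S)"
      by (rule bounded_bilinear.bounded_linear_right[OF bounded_bilinear_blinfun_compose])
    show "ev o\<^sub>L rank_one_op f y0 = f" for f :: "'a \<Rightarrow>\<^sub>L real"
      by (rule blinfun_eqI) (simp add: ev rank_one_op_apply blinfun.scaleR_left b)
    show "\<exists>z. \<forall>f. ptensor_dual (rank_one_op f y0) u = f z" for u :: "('a, 'b) ptensor"
    proof (rule ptensor_dual_bilinear_image[where B = "\<lambda>x y. y0 y *\<^sub>R x"])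
      show "bounded_bilinear (\<lambda>x y. y0 y *\<^sub>R x)"
        by (rule bounded_bilinear.flip[OF bounded_bilinear.comp1[OF bounded_bilinear_scaleR
                blinfun.bounded_linear_right]])
      show "rank_one_op f y0 x y = f (y0 y *\<^sub>R x)" for f :: "'a \<Rightarrow>\<^sub>L real" and x y
        by (simp add: rank_one_op_apply blinfun.bilinear_simps)
    qed
    show "norm (rank_one_op f y0) \<le> norm f" for f :: "'a \<Rightarrow>\<^sub>L real"
      using norm_rank_one_op_le[of f y0] norm(2) by simp
  qed (fact norm(1) norm(2) assms(3))+
  show "weak_star_strongly_extreme (\<lambda>g :: 'b \<Rightarrow>\<^sub>L real. g) y0"
  proof (rule weak_star_strongly_extreme_pullback[OF bounded_linear_ptensor_dual,
        where E = "\<lambda>g. rank_one_op x0 g" and P = "\<lambda>S. S a"])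
    show "bounded_linear (\<lambda>S :: 'a \<Rightarrow>\<^sub>L ('b \<Rightarrow>\<^sub>L real). S a)"
      by (rule blinfun.bounded_linear_left)
    show "rank_one_op x0 g a = g" for g :: "'b \<Rightarrow>\<^sub>L real"
      by (simp add: rank_one_op_apply a)
    show "\<exists>z. \<forall>g. ptensor_dual (rank_one_op x0 g) u = g z" for u :: "('a, 'b) ptensor"
    proof (rule ptensor_dual_bilinear_image[where B = "\<lambda>x y. x0 x *\<^sub>R y"])
      show "bounded_bilinear (\<lambda>x y. x0 x *\<^sub>R y)"
        by (rule bounded_bilinear.comp1[OF bounded_bilinear_scaleR blinfun.bounded_linear_right])
      show "rank_one_op x0 g x y = g (x0 x *\<^sub>R y)" for g :: "'b \<Rightarrow>\<^sub>L real" and x y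
        by (simp add: rank_one_op_apply blinfun.bilinear_simps)
    qed
    show "norm (rank_one_op x0 g) \<le> norm g" for g :: "'b \<Rightarrow>\<^sub>L real"
      using norm_rank_one_op_le[of x0 g] norm(1) by simp
  qed (fact norm(1) norm(2) assms(3))+
qed

end
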